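(* Let $a<b$ be real numbers and let $f:[a,b]\to\mathbb{R}$ be a twice differentiable function such that there exist real constants $m$ and $M$ with $m\le f''(x)\le M$ for all $x\in[a,b]$. Assume $g:[a,b]\to\mathbb{R}_+$ is integrable and symmetric about $\frac{a+b}{2}$. Then the following inequalities hold: $$\frac{m}{2}\int_a^b (t-a)(b-t)g(t)\,\mathrm{d}t\le \frac{f(a)+f(b)}{2}\int_a^b g(t)\,\mathrm{d}t-\int_a^b f(t)g(t)\,\mathrm{d}t\le \frac{M}{2}\int_a^b (t-a)(b-t)g(t)\,\mathrm{d}t$$ and $$\frac{m}{8}\int_a^b (2t-a-b)^2g(t)\,\mathrm{d}t\le \int_a^b f(t)g(t)\,\mathrm{d}t-f\left(\frac{a+b}{2}\right)\int_a^b g(t)\,\mathrm{d}t\le \frac{M}{8}\int_a^b (2t-a-b)^2g(t)\,\mathrm{d}t.$$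
   Context: $\mathbb{R}_+=[0,\infty)$. A function $g$ on $[a,b]$ is symmetric about $\frac{a+b}{2}$ if $g(x)=g(a+b-x)$ for all $x\in[a,b]$. *)

theory Defs
  imports "HOL-Analysis.Analysis"
begin

definition symmetric_about_midpoint :: "real \<Rightarrow> real \<Rightarrow> (real \<Rightarrow> real) \<Rightarrow> bool" where
  "symmetric_about_midpoint a b g \<longleftrightarrow> (\<forall>x\<in>{a..b}. g x = g (a + b - x))"

end

theory Submission
  imports Defs
begin

text \<open>
  Since \<open>g\<close> is symmetric, \<open>t\<close> and its mirror image \<open>a + b - t\<close> carry the same weight, so an integral
  \<open>\<integral> F g\<close> only sees the symmetrised function \<open>F t + F (a + b - t)\<close>; in particular it is
  nonnegative as soon as that sum is (\<open>weighted_integral_nonneg\<close>).  It therefore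
  suffices to understand sums over mirror pairs.

  Put \<open>h t = f t - (m / 2) t\<^sup>2\<close>, so that \<open>h'' \<ge> 0\<close>.  The sum \<open>h t + h (a + b - t)\<close> has derivative
  \<open>h' t - h' (a + b - t)\<close>, which is nonnegative to the right of the midpoint.  The sum thus grows
  from \<open>2 h ((a + b) / 2)\<close> at the midpoint to \<open>h a + h b\<close> at the end point
  (\<open>mirror_sum_bounds\<close>).  For the quadratic part, the gaps between the sum over a mirror
  pair and its two extreme values are, up to a constant factor, the weights of the theorem:
  \<open>a\<^sup>2 + b\<^sup>2 - (t\<^sup>2 + (a + b - t)\<^sup>2) = 2 (t - a) (b - t)\<close> and
  \<open>t\<^sup>2 + (a + b - t)\<^sup>2 - 2 ((a + b) / 2)\<^sup>2 = (2 t - a - b)\<^sup>2 / 2\<close>.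
  This gives both lower bounds; the upper bounds are the lower bounds for \<open>- f\<close>
  and \<open>- M\<close>.
\<close>

text \<open>
  A gauge integrable \<open>g\<close> need not stay integrable after multiplication by a continuous function.
  Nonnegativity makes \<open>g\<close> absolutely integrable, and bounded measurable factors preserve that.
\<close>

lemma integrable_continuous_times_nonneg:
  fixes F g :: "real \<Rightarrow> real"
  assumes F: "continuous_on {a..b} F"
    and g: "g integrable_on {a..b}" "\<And>x. x \<in> {a..b} \<Longrightarrow> 0 \<le> g x"
  shows "(\<lambda>t. F t * g t) integrable_on {a..b}"
proof (rule set_lebesgue_integral_eq_integral(1)[OF absolutely_integrable_bounded_measurable_product_real])
  show "F \<in> borel_measurable (lebesgue_on {a..b})"
    using F by (intro continuous_imp_measurable_on_sets_lebesgue) auto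
  show "bounded (F ` {a..b})"
    by (intro compact_imp_bounded compact_continuous_image F) auto
  show "g absolutely_integrable_on {a..b}"
    using g by (intro nonnegative_absolutely_integrable_1) auto
qed auto

lemma integral_mirror:
  fixes F :: "real \<Rightarrow> real"
  shows "integral {a..b} (\<lambda>t. F (a + b - t)) = integral {a..b} F"
proof -
  have "integral {a..b} (\<lambda>t. F (a + b - t)) = integral {-b..-a} (\<lambda>t. F (a + b + t))"
    using Henstock_Kurzweil_Integration.integral_reflect_real
        [where f = "\<lambda>t. F (a + b + t)" and a = "-b" and b = "-a"]
    by simp
  also have "\<dots> = integral {a..b} F"
    using integral_shift_real_ivl[where f = F and a = a and b = b and c = "a + b"]
    by (simp add: add.commute)
  finally show ?thesis .
qed

text \<open>
  Reflecting the interval replaces \<open>F\<close> by its mirror image without changing the integral, so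
  twice the integral is that of the symmetrised function times \<open>g\<close>.  The sign condition is on the
  symmetrised function because the \<open>F\<close> of interest, such as \<open>f - f ((a + b) / 2)\<close> minus
  a quadratic, may change sign.
\<close>

lemma weighted_integral_nonneg:
  fixes F g :: "real \<Rightarrow> real"
  assumes F: "continuous_on {a..b} F"
    and g: "g integrable_on {a..b}" "\<And>x. x \<in> {a..b} \<Longrightarrow> 0 \<le> g x"
    and sym: "symmetric_about_midpoint a b g"
    and pair: "\<And>t. t \<in> {a..b} \<Longrightarrow> 0 \<le> F t + F (a + b - t)"
  shows "0 \<le> integral {a..b} (\<lambda>t. F t * g t)"
proof -
  have F_mirror: "continuous_on {a..b} (\<lambda>t. F (a + b - t))"
    by (rule continuous_on_compose2[OF F]) (auto intro!: continuous_intros)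
  have int: "(\<lambda>t. F t * g t) integrable_on {a..b}"
      "(\<lambda>t. F (a + b - t) * g t) integrable_on {a..b}"
    using g by (intro integrable_continuous_times_nonneg F F_mirror; simp)+
  have mirror: "g t = g (a + b - t)" if "t \<in> {a..b}" for t
    using sym that unfolding symmetric_about_midpoint_def by blast
  have "integral {a..b} (\<lambda>t. F (a + b - t) * g t)
      = integral {a..b} (\<lambda>t. F (a + b - t) * g (a + b - t))"
    by (rule integral_cong) (simp only: mirror)
  also have "\<dots> = integral {a..b} (\<lambda>t. F t * g t)"
    by (rule integral_mirror)
  finally have "2 * integral {a..b} (\<lambda>t. F t * g t)
      = integral {a..b} (\<lambda>t. F t * g t + F (a + b - t) * g t)"
    using int by (simp add: integral_add)
  also have "\<dots> \<ge> 0"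
  proof (rule integral_nonneg)
    show "(\<lambda>t. F t * g t + F (a + b - t) * g t) integrable_on {a..b}"
      using int by (rule integrable_add)
    show "0 \<le> F t * g t + F (a + b - t) * g t" if "t \<in> {a..b}" for t
      using mult_nonneg_nonneg[OF pair[OF that] g(2)[OF that]] by (simp add: algebra_simps)
  qed
  finally show ?thesis by simp
qed

text \<open>
  A monotone derivative is convexity in the form used here: moving two mirror points apart
  does not decrease the sum of the values, because the right point gains at least as much as the left
  point loses.
\<close>

lemma mirror_sum_bounds:
  fixes h h' :: "real \<Rightarrow> real"
  assumes deriv: "\<And>x. x \<in> {a..b} \<Longrightarrow> (h has_real_derivative h' x) (at x within {a..b})"
    and mono: "mono_on {a..b} h'"
    and t: "t \<in> {a..b}"
  shows "2 * h ((a + b) / 2) \<le> h t + h (a + b - t)"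
    and "h t + h (a + b - t) \<le> h a + h b"
proof -
  define S where "S = (\<lambda>x. h x + h (a + b - x))"
  have cont_h: "continuous_on {a..b} h"
    using deriv by (rule DERIV_continuous_on)
  have cont_S: "continuous_on {a..b} S"
    unfolding S_def
    by (intro continuous_on_add cont_h continuous_on_compose2[OF cont_h])
       (auto intro!: continuous_intros)
  have increasing: "S x \<le> S y" if "(a + b) / 2 \<le> x" "x \<le> y" "y \<le> b" for x y
  proof (rule DERIV_nonneg_imp_increasing_open[where f = S])
    show "x \<le> y" by fact
    show "continuous_on {x..y} S"
      using that by (intro continuous_on_subset[OF cont_S]) auto
    fix z assume z: "x < z" "z < y"
    have interior_deriv: "(h has_real_derivative h' w) (at w)" if "a < w" "w < b" for w
      using deriv[of w] that by (simp add: at_within_Icc_at)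
    have "(h has_real_derivative h' (a + b - z)) (at (a + b - z))"
      using interior_deriv that z by (simp add: field_simps)
    then have "((\<lambda>x. h (a + b - x)) has_real_derivative h' (a + b - z) * (-1)) (at z)"
      by (rule DERIV_chain2) (auto intro!: derivative_eq_intros)
    then have "(S has_real_derivative h' z + h' (a + b - z) * (-1)) (at z)"
      unfolding S_def using interior_deriv that z by (intro DERIV_add) auto
    moreover have "h' (a + b - z) \<le> h' z"
      using that z by (intro mono_onD[OF mono]) (auto simp: field_simps)
    ultimately show "\<exists>d. (S has_real_derivative d) (at z) \<and> 0 \<le> d"
      by (intro exI[of _ "h' z + h' (a + b - z) * (-1)"]) simp
  qed
  \<comment> \<open>The claim does not distinguish \<open>t\<close> from its mirror image, so the right one of the two is used.\<close>
  define u where "u = max t (a + b - t)"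
  have u: "(a + b) / 2 \<le> u" "u \<le> b" and Su: "S u = h t + h (a + b - t)"
    using t by (auto simp: u_def S_def max_def field_simps)
  have "S ((a + b) / 2) \<le> S u" "S u \<le> S b"
    using u by (auto intro!: increasing)
  moreover have "a + b - (a + b) / 2 = (a + b) / 2"
    by (simp add: field_simps)
  ultimately show "2 * h ((a + b) / 2) \<le> h t + h (a + b - t)"
    and "h t + h (a + b - t) \<le> h a + h b"
    unfolding Su by (simp_all add: S_def)
qed

text \<open>
  The bound \<open>m \<le> f''\<close> says that \<open>f x - (m / 2) x\<^sup>2\<close> has a monotone derivative.  Applying
  \<open>mirror_sum_bounds\<close> to it leaves the quadratic gaps on the left-hand sides.
\<close>

lemma mirror_sum_gaps:
  fixes f f' f'' :: "real \<Rightarrow> real"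
  assumes f: "\<And>x. x \<in> {a..b} \<Longrightarrow> (f has_real_derivative f' x) (at x within {a..b})"
    and f': "\<And>x. x \<in> {a..b} \<Longrightarrow> (f' has_real_derivative f'' x) (at x within {a..b})"
    and m: "\<And>x. x \<in> {a..b} \<Longrightarrow> m \<le> f'' x"
    and t: "t \<in> {a..b}"
  shows "m * ((t - a) * (b - t)) \<le> f a + f b - (f t + f (a + b - t))"
    and "m / 4 * (2 * t - a - b)\<^sup>2 \<le> f t + f (a + b - t) - 2 * f ((a + b) / 2)"
proof -
  define h where "h = (\<lambda>x. f x - m / 2 * x\<^sup>2)"
  define h' where "h' = (\<lambda>x. f' x - m * x)"
  have h: "(h has_real_derivative h' x) (at x within {a..b})" if "x \<in> {a..b}" for x
    unfolding h_def h'_def using f[OF that] by (auto intro!: derivative_eq_intros)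
  have h': "(h' has_real_derivative f'' x - m) (at x within {a..b})" if "x \<in> {a..b}" for x
    unfolding h'_def using f'[OF that] by (auto intro!: derivative_eq_intros)
  have cont_h': "continuous_on {a..b} h'"
    using h' by (rule DERIV_continuous_on)
  have mono: "mono_on {a..b} h'"
  proof (rule mono_onI)
    fix x y assume xy: "x \<in> {a..b}" "y \<in> {a..b}" "x \<le> y"
    show "h' x \<le> h' y"
    proof (rule DERIV_nonneg_imp_increasing_open[where f = h'])
      show "x \<le> y" by fact
      show "continuous_on {x..y} h'"
        using xy by (intro continuous_on_subset[OF cont_h']) auto
      fix z assume "x < z" "z < y"
      then have z: "a < z" "z < b"
        using xy by auto
      then have "(h' has_real_derivative f'' z - m) (at z)"
        using h'[of z] by (simp add: at_within_Icc_at)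
      then show "\<exists>d. (h' has_real_derivative d) (at z) \<and> 0 \<le> d"
        using m[of z] z by (intro exI[of _ "f'' z - m"]) simp
    qed
  qed
  have lower: "2 * h ((a + b) / 2) \<le> h t + h (a + b - t)"
    and upper: "h t + h (a + b - t) \<le> h a + h b"
    by (rule mirror_sum_bounds[where h = h and h' = h']; use h mono t in blast)+
  have "m / 2 * (a\<^sup>2 + b\<^sup>2) - m / 2 * (t\<^sup>2 + (a + b - t)\<^sup>2) = m * ((t - a) * (b - t))"
    by (simp add: power2_eq_square field_simps)
  with upper show "m * ((t - a) * (b - t)) \<le> f a + f b - (f t + f (a + b - t))"
    by (simp add: h_def algebra_simps)
  have "m / 2 * (t\<^sup>2 + (a + b - t)\<^sup>2) - m * ((a + b) / 2)\<^sup>2 = m / 4 * (2 * t - a - b)\<^sup>2"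
    by (simp add: power2_eq_square field_simps)
  with lower show "m / 4 * (2 * t - a - b)\<^sup>2 \<le> f t + f (a + b - t) - 2 * f ((a + b) / 2)"
    by (simp add: h_def algebra_simps)
qed

text \<open>
  In each inequality the right-hand side minus the left-hand side is a single integral
  \<open>\<integral> F g\<close>, and \<open>mirror_sum_gaps\<close> says that the symmetrisation of \<open>F\<close> is nonnegative.
  Both quadratic weights are invariant under the reflection, so they enter that
  symmetrisation twice; this halves the constants \<open>m\<close> and \<open>m / 4\<close> of the pairwise gaps.
\<close>

lemma fejer_lower_bounds:
  fixes f f' f'' g :: "real \<Rightarrow> real"
  assumes f: "\<And>x. x \<in> {a..b} \<Longrightarrow> (f has_real_derivative f' x) (at x within {a..b})"
    and f': "\<And>x. x \<in> {a..b} \<Longrightarrow> (f' has_real_derivative f'' x) (at x within {a..b})"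
    and m: "\<And>x. x \<in> {a..b} \<Longrightarrow> m \<le> f'' x"
    and g: "g integrable_on {a..b}" "\<And>x. x \<in> {a..b} \<Longrightarrow> 0 \<le> g x"
    and sym: "symmetric_about_midpoint a b g"
  shows "m / 2 * integral {a..b} (\<lambda>t. (t - a) * (b - t) * g t)
      \<le> (f a + f b) / 2 * integral {a..b} g - integral {a..b} (\<lambda>t. f t * g t)"
    and "m / 8 * integral {a..b} (\<lambda>t. (2 * t - a - b)\<^sup>2 * g t)
      \<le> integral {a..b} (\<lambda>t. f t * g t) - f ((a + b) / 2) * integral {a..b} g"
proof -
  have cont_f: "continuous_on {a..b} f"
    using f by (rule DERIV_continuous_on)
  have int: "(\<lambda>t. F t * g t) integrable_on {a..b}" if "continuous_on {a..b} F" for F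
    using that g by (rule integrable_continuous_times_nonneg)
  have combination: "integral {a..b} (\<lambda>t. (c * f t + d + e * q t) * g t)
      = c * integral {a..b} (\<lambda>t. f t * g t) + d * integral {a..b} g
        + e * integral {a..b} (\<lambda>t. q t * g t)"
    if "continuous_on {a..b} q" for c d e :: real and q
  proof -
    have "integral {a..b} (\<lambda>t. (c * f t + d + e * q t) * g t)
        = integral {a..b} (\<lambda>t. c * (f t * g t) + d * g t + e * (q t * g t))"
      by (simp add: algebra_simps)
    also have "\<dots> = integral {a..b} (\<lambda>t. c * (f t * g t)) + integral {a..b} (\<lambda>t. d * g t)
        + integral {a..b} (\<lambda>t. e * (q t * g t))"
      using int[OF cont_f] int[OF that] g(1)
      by (simp add: integral_add integrable_add integrable_on_mult_right)
    finally show ?thesis by simp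
  qed
  have gap_ends: "m * ((t - a) * (b - t)) \<le> f a + f b - (f t + f (a + b - t))"
    and gap_mid: "m / 4 * (2 * t - a - b)\<^sup>2 \<le> f t + f (a + b - t) - 2 * f ((a + b) / 2)"
    if "t \<in> {a..b}" for t
    by (rule mirror_sum_gaps[where f = f and f' = f' and f'' = f'']; use f f' m that in blast)+
  \<comment> \<open>The coefficients \<open>-1\<close> and, below, \<open>1\<close> of \<open>f\<close> are written out so that the integrands match
    \<open>combination\<close> syntactically.\<close>
  have "0 \<le> integral {a..b}
      (\<lambda>t. ((-1) * f t + (f a + f b) / 2 + (- (m / 2)) * ((t - a) * (b - t))) * g t)"
  proof (rule weighted_integral_nonneg[OF _ g sym])
    show "continuous_on {a..b}
        (\<lambda>t. (-1) * f t + (f a + f b) / 2 + (- (m / 2)) * ((t - a) * (b - t)))"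
      by (intro continuous_intros cont_f)
  next
    fix t assume "t \<in> {a..b}"
    from gap_ends[OF this]
    show "0 \<le> ((-1) * f t + (f a + f b) / 2 + (- (m / 2)) * ((t - a) * (b - t)))
        + ((-1) * f (a + b - t) + (f a + f b) / 2
            + (- (m / 2)) * ((a + b - t - a) * (b - (a + b - t))))"
      by (simp add: algebra_simps)
  qed
  also have "\<dots> = (-1) * integral {a..b} (\<lambda>t. f t * g t) + (f a + f b) / 2 * integral {a..b} g
      + (- (m / 2)) * integral {a..b} (\<lambda>t. (t - a) * (b - t) * g t)"
    by (rule combination) (intro continuous_intros)
  finally show "m / 2 * integral {a..b} (\<lambda>t. (t - a) * (b - t) * g t)
      \<le> (f a + f b) / 2 * integral {a..b} g - integral {a..b} (\<lambda>t. f t * g t)"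
    by simp
  have "0 \<le> integral {a..b}
      (\<lambda>t. (1 * f t + (- f ((a + b) / 2)) + (- (m / 8)) * (2 * t - a - b)\<^sup>2) * g t)"
  proof (rule weighted_integral_nonneg[OF _ g sym])
    show "continuous_on {a..b}
        (\<lambda>t. 1 * f t + (- f ((a + b) / 2)) + (- (m / 8)) * (2 * t - a - b)\<^sup>2)"
      by (intro continuous_intros cont_f)
  next
    fix t assume t: "t \<in> {a..b}"
    have "(2 * (a + b - t) - a - b)\<^sup>2 = (2 * t - a - b)\<^sup>2"
      by (simp add: power2_eq_square algebra_simps)
    with gap_mid[OF t]
    show "0 \<le> (1 * f t + (- f ((a + b) / 2)) + (- (m / 8)) * (2 * t - a - b)\<^sup>2)
        + (1 * f (a + b - t) + (- f ((a + b) / 2)) + (- (m / 8)) * (2 * (a + b - t) - a - b)\<^sup>2)"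
      by simp
  qed
  also have "\<dots> = 1 * integral {a..b} (\<lambda>t. f t * g t) + (- f ((a + b) / 2)) * integral {a..b} g
      + (- (m / 8)) * integral {a..b} (\<lambda>t. (2 * t - a - b)\<^sup>2 * g t)"
    by (rule combination) (intro continuous_intros)
  finally show "m / 8 * integral {a..b} (\<lambda>t. (2 * t - a - b)\<^sup>2 * g t)
      \<le> integral {a..b} (\<lambda>t. f t * g t) - f ((a + b) / 2) * integral {a..b} g"
    by simp
qed

theorem theorem2p5:
  fixes a b m M :: real and f f' f'' g :: "real \<Rightarrow> real"
  assumes "a < b"
    and "\<And>x. x \<in> {a..b} \<Longrightarrow> (f has_real_derivative f' x) (at x within {a..b})"
    and "\<And>x. x \<in> {a..b} \<Longrightarrow> (f' has_real_derivative f'' x) (at x within {a..b})"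
    and "\<And>x. x \<in> {a..b} \<Longrightarrow> m \<le> f'' x \<and> f'' x \<le> M"
    and "\<And>x. x \<in> {a..b} \<Longrightarrow> 0 \<le> g x"
    and "g integrable_on {a..b}"
    and "symmetric_about_midpoint a b g"
  shows "(m / 2 * integral {a..b} (\<lambda>t. (t - a) * (b - t) * g t)
            \<le> (f a + f b) / 2 * integral {a..b} g - integral {a..b} (\<lambda>t. f t * g t)
          \<and> (f a + f b) / 2 * integral {a..b} g - integral {a..b} (\<lambda>t. f t * g t)
            \<le> M / 2 * integral {a..b} (\<lambda>t. (t - a) * (b - t) * g t))
       \<and> (m / 8 * integral {a..b} (\<lambda>t. (2 * t - a - b)\<^sup>2 * g t)
            \<le> integral {a..b} (\<lambda>t. f t * g t) - f ((a + b) / 2) * integral {a..b} g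
          \<and> integral {a..b} (\<lambda>t. f t * g t) - f ((a + b) / 2) * integral {a..b} g
            \<le> M / 8 * integral {a..b} (\<lambda>t. (2 * t - a - b)\<^sup>2 * g t))"
proof -
  have "m / 2 * integral {a..b} (\<lambda>t. (t - a) * (b - t) * g t)
      \<le> (f a + f b) / 2 * integral {a..b} g - integral {a..b} (\<lambda>t. f t * g t)"
    and "m / 8 * integral {a..b} (\<lambda>t. (2 * t - a - b)\<^sup>2 * g t)
      \<le> integral {a..b} (\<lambda>t. f t * g t) - f ((a + b) / 2) * integral {a..b} g"
    by (rule fejer_lower_bounds[of a b f f' f'' m g]; use assms in blast)+
  moreover have "(- M) / 2 * integral {a..b} (\<lambda>t. (t - a) * (b - t) * g t)
      \<le> (- f a + - f b) / 2 * integral {a..b} g - integral {a..b} (\<lambda>t. - f t * g t)"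
    and "(- M) / 8 * integral {a..b} (\<lambda>t. (2 * t - a - b)\<^sup>2 * g t)
      \<le> integral {a..b} (\<lambda>t. - f t * g t) - (- f ((a + b) / 2)) * integral {a..b} g"
    by (rule fejer_lower_bounds[of a b "\<lambda>x. - f x" "\<lambda>x. - f' x" "\<lambda>x. - f'' x" "- M" g];
        use assms in \<open>blast intro: DERIV_minus le_imp_neg_le\<close>)+
  moreover have "integral {a..b} (\<lambda>t. - f t * g t) = - integral {a..b} (\<lambda>t. f t * g t)"
    by simp
  moreover have "(- f a + - f b) / 2 * integral {a..b} g = - ((f a + f b) / 2 * integral {a..b} g)"
    by (simp add: field_simps)
  ultimately show ?thesis
    by simp
qed

end
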